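(* Let $G=(V,E)$ be a finite graph with symmetric positive edge weights $w_{xy}=w_{yx}>0$ and a finite measure $\mu:V\to(0,\infty)$, let $\Delta$ be the associated $\mu$-Laplacian, let $c$ be a positive constant, and let $h:V\to\mathbb{R}$ be a function. Then the equation $$\Delta u=c-he^{u}\quad\text{in } V$$ has a solution $u:V\to\mathbb{R}$ if and only if $h$ is positive somewhere, i.e. $h(x)>0$ for some $x\in V$.
   Context: For $u:V\to\mathbb{R}$, the $\mu$-Laplacian is $\Delta u(x)=\frac{1}{\mu(x)}\sum_{y\sim x}w_{xy}(u(y)-u(x))$, where $y\sim x$ means $xy\in E$.
   Formalization: The graph is additionally assumed connected and nonempty; without this the claim fails (two isolated vertices with h = 1 and h = 0 admit no solution, and on the empty graph the equation is vacuously solvable). *)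

theory Defs
  imports Complex_Main "Graph_Theory.Digraph_Component"
begin

text \<open>
  An undirected simple graph is a symmetric digraph without loops or parallel arcs (locale
  \<^locale>\<open>graph\<close>), so adjacency is \<^const>\<open>dominates\<close>. The functions \<open>w\<close>, \<open>\<mu>\<close>, \<open>u\<close> are total on the
  vertex type; only their values on edges and vertices of \<open>G\<close> matter.
\<close>

definition mu_laplacian ::
  "('a, 'b) pre_digraph \<Rightarrow> ('a \<Rightarrow> 'a \<Rightarrow> real) \<Rightarrow> ('a \<Rightarrow> real) \<Rightarrow> ('a \<Rightarrow> real) \<Rightarrow> 'a \<Rightarrow> real"
where
  "mu_laplacian G w \<mu> u x = 1 / \<mu> x * (\<Sum>y | x \<rightarrow>\<^bsub>G\<^esub> y. w x y * (u y - u x))"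

end

theory Submission
  imports Defs "HOL-Analysis.Function_Topology"
begin

text \<open>
  Summing \<open>\<mu> \<cdot> \<Delta>u\<close> over the graph gives zero, so a solution satisfies
  \<open>\<Sum> \<mu> h e\<^sup>u = c \<Sum> \<mu> > 0\<close>, whence \<open>h\<close> is positive somewhere. Conversely, minimise
  \<open>J u = 1/2 \<integral> |\<nabla>u|\<^sup>2 + c \<Sum> \<mu> u\<close> subject to \<open>\<Sum> \<mu> h e\<^sup>u = 1\<close>. The constraint bounds
  \<open>max u\<close> from below, and connectedness bounds the oscillation of \<open>u\<close> by the square root of the
  energy; hence sublevel sets of \<open>J\<close> are bounded and a minimiser exists. Since adding a constant
  to any \<open>u\<close> with \<open>\<Sum> \<mu> h e\<^sup>u > 0\<close> restores the constraint, the minimiser is a critical point of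
  \<open>J u - c (\<Sum> \<mu>) ln (\<Sum> \<mu> h e\<^sup>u)\<close>, and its Euler--Lagrange equation is the required equation up
  to an additive constant.
\<close>

section \<open>Dirichlet energy on a finite network\<close>

text \<open>Conductances \<open>a\<close> vanish off the edges, so every sum can run over the whole
  of \<open>V\<close>. Connectedness enters as \<open>irreducible\<close>: any two vertices are
  joined by a path of positive conductances.\<close>

locale network =
  fixes V :: "'a set" and a :: "'a \<Rightarrow> 'a \<Rightarrow> real"
  assumes finite_V: "finite V"
    and nonempty: "V \<noteq> {}"
    and conductance_nonneg: "a x y \<ge> 0"
    and conductance_sym: "a x y = a y x"
    and edge_in_V: "a x y > 0 \<Longrightarrow> y \<in> V"
    and irreducible: "x \<in> V \<Longrightarrow> y \<in> V \<Longrightarrow> (x, y) \<in> {(x, y). a x y > 0}\<^sup>*"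
begin

definition lap :: "('a \<Rightarrow> real) \<Rightarrow> 'a \<Rightarrow> real" where
  "lap u x = (\<Sum>y\<in>V. a x y * (u y - u x))"

text \<open>Both orientations of an edge are counted, so this is twice \<open>\<integral> |\<nabla>u|\<^sup>2\<close>.\<close>
definition energy :: "('a \<Rightarrow> real) \<Rightarrow> real" where
  "energy u = (\<Sum>x\<in>V. \<Sum>y\<in>V. a x y * (u y - u x)\<^sup>2)"

lemma energy_nonneg: "energy u \<ge> 0"
  unfolding energy_def by (intro sum_nonneg mult_nonneg_nonneg conductance_nonneg) auto

text \<open>Summation by parts: exchanging \<open>x\<close> and \<open>y\<close> and using the
  symmetry of \<open>a\<close> turns the \<open>\<phi> y\<close> half into the negative of the
  \<open>\<phi> x\<close> half.\<close>

lemma green: "(\<Sum>x\<in>V. \<Sum>y\<in>V. a x y * ((u y - u x) * (\<phi> y - \<phi> x))) = - 2 * (\<Sum>x\<in>V. \<phi> x * lap u x)"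
proof -
  have "(\<Sum>x\<in>V. \<Sum>y\<in>V. a x y * ((u y - u x) * \<phi> y)) = (\<Sum>x\<in>V. \<Sum>y\<in>V. a y x * ((u x - u y) * \<phi> x))"
    by (rule sum.swap)
  also have "\<dots> = (\<Sum>x\<in>V. \<Sum>y\<in>V. - (a x y * ((u y - u x) * \<phi> x)))"
    by (intro sum.cong refl, subst conductance_sym) (simp add: algebra_simps)
  finally have swap: "(\<Sum>x\<in>V. \<Sum>y\<in>V. a x y * ((u y - u x) * \<phi> y))
      = - (\<Sum>x\<in>V. \<Sum>y\<in>V. a x y * ((u y - u x) * \<phi> x))"
    by (simp add: sum_negf)
  have "(\<Sum>x\<in>V. \<Sum>y\<in>V. a x y * ((u y - u x) * \<phi> x)) = (\<Sum>x\<in>V. \<phi> x * lap u x)"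
    by (simp add: lap_def sum_distrib_left algebra_simps)
  with swap show ?thesis
    by (simp add: right_diff_distrib sum_subtractf)
qed

lemma sum_lap: "(\<Sum>x\<in>V. lap u x) = 0"
  using green[of u "\<lambda>_. 1"] by simp

lemma lap_add_const: "lap (\<lambda>x. u x + s) x = lap u x"
  by (simp add: lap_def)

section \<open>Oscillation controlled by the energy\<close>

lemma edge_difference_bound:
  assumes "a x y > 0"
  shows "\<bar>u x - u y\<bar> \<le> sqrt (1 / a x y) * sqrt (energy u)"
proof -
  have V: "x \<in> V" "y \<in> V"
    using assms edge_in_V conductance_sym by metis+
  have "a x y * (u y - u x)\<^sup>2 \<le> (\<Sum>y\<in>V. a x y * (u y - u x)\<^sup>2)"
    using V finite_V conductance_nonneg by (intro member_le_sum) auto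
  also have "\<dots> \<le> energy u"
    unfolding energy_def using V finite_V conductance_nonneg
    by (intro member_le_sum[where f = "\<lambda>x. \<Sum>y\<in>V. a x y * (u y - u x)\<^sup>2"] sum_nonneg) auto
  finally have "(u x - u y)\<^sup>2 \<le> 1 / a x y * energy u"
    using assms by (simp add: field_simps power2_commute)
  then have "\<bar>u x - u y\<bar> \<le> sqrt (1 / a x y * energy u)"
    using real_le_rsqrt[of "\<bar>u x - u y\<bar>"] by simp
  then show ?thesis
    by (simp add: real_sqrt_mult real_sqrt_divide)
qed

text \<open>Triangle inequality along a path, adding one edge bound per step. The constant depends
  on the path only, hence is uniform in \<open>u\<close>.\<close>

lemma difference_bound:
  assumes "(x, y) \<in> {(x, y). a x y > 0}\<^sup>*"
  shows "\<exists>D. \<forall>u. \<bar>u x - u y\<bar> \<le> D * sqrt (energy u)"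
  using assms
proof (induction rule: rtrancl_induct)
  case base
  show ?case by (rule exI[of _ 0]) simp
next
  case (step y z)
  then obtain D where D: "\<bar>u x - u y\<bar> \<le> D * sqrt (energy u)" for u
    by blast
  have "\<bar>u x - u z\<bar> \<le> (D + sqrt (1 / a y z)) * sqrt (energy u)" for u
    using D[of u] edge_difference_bound[of y z u] step.hyps(2) by (simp add: distrib_right)
  then show ?case by blast
qed

lemma oscillation_bound:
  obtains D where "D \<ge> 0" "\<And>u x y. x \<in> V \<Longrightarrow> y \<in> V \<Longrightarrow> \<bar>u x - u y\<bar> \<le> D * sqrt (energy u)"
proof -
  have "\<forall>x\<in>V. \<forall>y\<in>V. \<exists>D. \<forall>u. \<bar>u x - u y\<bar> \<le> D * sqrt (energy u)"
    using irreducible difference_bound by blast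
  then obtain D where D: "\<And>x y u. x \<in> V \<Longrightarrow> y \<in> V \<Longrightarrow> \<bar>u x - u y\<bar> \<le> D x y * sqrt (energy u)"
    by metis
  let ?D = "\<Sum>x\<in>V. \<Sum>y\<in>V. \<bar>D x y\<bar>"
  have "\<bar>u x - u y\<bar> \<le> ?D * sqrt (energy u)" if "x \<in> V" "y \<in> V" for u x y
  proof -
    have "D x y \<le> \<bar>D x y\<bar>" by simp
    also have "\<dots> \<le> (\<Sum>y\<in>V. \<bar>D x y\<bar>)"
      using that finite_V by (intro member_le_sum) auto
    also have "\<dots> \<le> ?D"
      using that finite_V
      by (intro member_le_sum[where f = "\<lambda>x. \<Sum>y\<in>V. \<bar>D x y\<bar>"] sum_nonneg) auto
    finally show ?thesis
      using D[OF that, of u] energy_nonneg[of u]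
      by (meson mult_right_mono order_trans real_sqrt_ge_zero)
  qed
  then show ?thesis
    by (intro that[of ?D] sum_nonneg) auto
qed

section \<open>The variational problem\<close>

context
  fixes m k :: "'a \<Rightarrow> real"
  assumes m_pos: "x \<in> V \<Longrightarrow> m x > 0"
begin

text \<open>The factor 1/4 offsets both the double counting of edges and the square, so that the
  gradient of \<open>J\<close> is exactly \<open>m - lap u\<close>.\<close>

definition J :: "('a \<Rightarrow> real) \<Rightarrow> real" where
  "J u = energy u / 4 + (\<Sum>x\<in>V. m x * u x)"

definition Z :: "('a \<Rightarrow> real) \<Rightarrow> real" where
  "Z u = (\<Sum>x\<in>V. k x * exp (u x))"

lemma total_mass_pos: "sum m V > 0"
  using m_pos finite_V nonempty by (intro sum_pos) auto

lemma J_cong: "(\<And>x. x \<in> V \<Longrightarrow> u x = v x) \<Longrightarrow> J u = J v"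
  by (simp add: J_def energy_def)

lemma Z_cong: "(\<And>x. x \<in> V \<Longrightarrow> u x = v x) \<Longrightarrow> Z u = Z v"
  by (simp add: Z_def)

lemma J_add_const: "J (\<lambda>x. u x + s) = J u + sum m V * s"
  by (simp add: J_def energy_def algebra_simps sum.distrib sum_distrib_left)

lemma Z_normalize:
  assumes "Z u > 0"
  shows "Z (\<lambda>x. u x + - ln (Z u)) = 1"
proof -
  have "Z (\<lambda>x. u x + - ln (Z u)) = (\<Sum>x\<in>V. k x * exp (u x)) / Z u"
    using assms unfolding Z_def[of "\<lambda>x. u x + - ln (Z u)"]
    by (simp add: exp_diff sum_divide_distrib)
  then show ?thesis
    using assms by (simp add: Z_def)
qed

lemma exists_Z_pos:
  assumes "z \<in> V" "k z > 0"
  shows "\<exists>u. Z u > 0"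
proof -
  \<comment> \<open>Concentrating \<open>exp u\<close> at \<open>z\<close> lets the positive term
    \<open>k z * s\<close> outweigh the remaining sum, whatever its sign.\<close>
  define s where "s = 1 + (\<bar>\<Sum>x\<in>V - {z}. k x\<bar> + 1) / k z"
  have s: "s > 0"
    using assms by (simp add: s_def add_pos_nonneg)
  have "Z (\<lambda>x. if x = z then ln s else 0) = k z * s + (\<Sum>x\<in>V - {z}. k x)"
    unfolding Z_def using assms finite_V s by (simp add: sum.remove[of _ z])
  also have "k z * s = k z + (\<bar>\<Sum>x\<in>V - {z}. k x\<bar> + 1)"
    using assms by (simp add: s_def field_simps)
  finally show ?thesis
    using assms by (intro exI[of _ "\<lambda>x. if x = z then ln s else 0"]) linarith
qed

section \<open>Coercivity under the constraint\<close>

text \<open>Replacing \<open>k\<close> by its absolute value and \<open>u\<close> by its maximum in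
  \<open>Z u = 1\<close>, then taking logarithms, gives
  \<open>b = - ln (\<Sum>y\<in>V. \<bar>k y\<bar>)\<close>.\<close>

lemma constraint_max_lower_bound:
  obtains b where "\<And>u. Z u = 1 \<Longrightarrow> \<exists>x\<in>V. u x \<ge> b \<and> (\<forall>y\<in>V. u y \<le> u x)"
proof
  fix u assume Z: "Z u = 1"
  have "Max (u ` V) \<in> u ` V"
    using finite_V nonempty by (intro Max_in) auto
  then obtain x where x: "x \<in> V" "u x = Max (u ` V)" by auto
  have max: "u y \<le> u x" if "y \<in> V" for y
    using that x finite_V by simp
  have "1 = (\<Sum>y\<in>V. k y * exp (u y))"
    using Z by (simp add: Z_def)
  also have "\<dots> \<le> (\<Sum>y\<in>V. \<bar>k y\<bar> * exp (u x))"
    using max by (intro sum_mono mult_mono) auto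
  finally have le: "1 \<le> (\<Sum>y\<in>V. \<bar>k y\<bar>) * exp (u x)"
    by (simp add: sum_distrib_right)
  then have pos: "(\<Sum>y\<in>V. \<bar>k y\<bar>) > 0"
    by (smt (verit) exp_gt_zero mult_nonpos_nonneg)
  have "0 \<le> ln ((\<Sum>y\<in>V. \<bar>k y\<bar>) * exp (u x))"
    using le by simp
  also have "\<dots> = ln (\<Sum>y\<in>V. \<bar>k y\<bar>) + u x"
    using pos by (simp add: ln_mult)
  finally show "\<exists>x\<in>V. u x \<ge> - ln (\<Sum>y\<in>V. \<bar>k y\<bar>) \<and> (\<forall>y\<in>V. u y \<le> u x)"
    using x(1) max by (intro bexI[of _ x]) auto
qed

lemma sublevel_bounded:
  obtains R where "\<And>u x. Z u = 1 \<Longrightarrow> J u \<le> t \<Longrightarrow> x \<in> V \<Longrightarrow> \<bar>u x\<bar> \<le> R"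
proof -
  obtain b where b: "\<And>u. Z u = 1 \<Longrightarrow> \<exists>x\<in>V. u x \<ge> b \<and> (\<forall>y\<in>V. u y \<le> u x)"
    using constraint_max_lower_bound by blast
  obtain D where D: "D \<ge> 0"
    "\<And>u x y. x \<in> V \<Longrightarrow> y \<in> V \<Longrightarrow> \<bar>u x - u y\<bar> \<le> D * sqrt (energy u)"
    using oscillation_bound by metis
  define K where "K = sum m V"
  define A where "A = t - K * b"
  \<comment> \<open>Chosen so that \<open>s > S\<close> forces \<open>s > 1\<close> and
    \<open>s / 4 - K * D > 1 / 4 + \<bar>A\<bar>\<close>, which contradicts the quadratic inequality
    \<open>quad\<close> below.\<close>
  define S where "S = 4 * (K * D) + 1 + 4 * \<bar>A\<bar>"
  define R where "R = \<bar>t\<bar> / K + \<bar>b\<bar> + D * S"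
  have K: "K > 0"
    using total_mass_pos by (simp add: K_def)
  have S: "S \<ge> 1"
    using K D(1) by (simp add: S_def)
  have "\<bar>u y\<bar> \<le> R" if Z: "Z u = 1" and J: "J u \<le> t" and y: "y \<in> V" for u y
  proof -
    obtain x where x: "x \<in> V" "u x \<ge> b" and max: "\<And>y. y \<in> V \<Longrightarrow> u y \<le> u x"
      using b[OF Z] by blast
    define s where "s = sqrt (energy u)"
    have s: "s \<ge> 0" "energy u = s\<^sup>2"
      using energy_nonneg[of u] by (auto simp: s_def)
    have low: "u x - D * s \<le> u y" if "y \<in> V" for y
      using D(2)[OF x(1) that, of u] by (simp add: s_def)
    have "K * (u x - D * s) = (\<Sum>y\<in>V. m y * (u x - D * s))"
      by (simp add: K_def sum_distrib_right)
    also have "\<dots> \<le> (\<Sum>y\<in>V. m y * u y)"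
      using low m_pos by (intro sum_mono mult_left_mono) (auto intro: less_imp_le)
    finally have coercive: "s\<^sup>2 / 4 + K * (u x - D * s) \<le> t"
      using J s by (simp add: J_def)
    have "K * b \<le> K * u x"
      using x K by simp
    then have quad: "s * (s / 4 - K * D) \<le> A"
      using coercive by (simp add: A_def power2_eq_square algebra_simps)
    have "s \<le> S"
    proof (rule ccontr)
      assume "\<not> s \<le> S"
      then have "1 \<le> s" "1 / 4 + \<bar>A\<bar> \<le> s / 4 - K * D"
        using S by (auto simp: S_def)
      then have "1 * (1 / 4 + \<bar>A\<bar>) \<le> s * (s / 4 - K * D)"
        by (intro mult_mono) auto
      then show False using quad by simp
    qed
    then have DS: "D * s \<le> D * S"
      using D(1) by (simp add: mult_left_mono)
    \<comment> \<open>Dropping the square bounds the maximum of \<open>u\<close> from above; with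
      \<open>b\<close> below and oscillation at most \<open>D * S\<close>, all values are
      bounded.\<close>
    have "K * (u x - D * s) \<le> \<bar>t\<bar>"
      using coercive zero_le_power2[of s] by linarith
    then have "u x - D * s \<le> \<bar>t\<bar> / K"
      using K by (simp add: field_simps)
    then show "\<bar>u y\<bar> \<le> R"
      using DS low[OF y] max[OF y] x(2) D(1) s(1) K
      by (smt (verit) R_def divide_nonneg_pos)
  qed
  then show ?thesis
    using that by blast
qed

section \<open>Existence of a minimiser\<close>

lemma continuous_J: "continuous_on UNIV J"
  unfolding J_def energy_def
  by (intro continuous_intros continuous_on_product_coordinates) auto

lemma continuous_Z: "continuous_on UNIV Z"
  unfolding Z_def
  by (intro continuous_intros continuous_on_product_coordinates)

lemma exists_minimizer:
  assumes "Z v > 0"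
  obtains u where "Z u = 1" "\<And>v. Z v = 1 \<Longrightarrow> J u \<le> J v"
proof -
  define v0 where "v0 = (\<lambda>x. v x + - ln (Z v))"
  have v0: "Z v0 = 1"
    using Z_normalize[OF assms] by (simp add: v0_def)
  obtain R where R: "\<And>u x. Z u = 1 \<Longrightarrow> J u \<le> J v0 \<Longrightarrow> x \<in> V \<Longrightarrow> \<bar>u x\<bar> \<le> R"
    using sublevel_bounded by blast
  \<comment> \<open>The type \<open>'a\<close> may be infinite, so coordinates outside
    \<open>V\<close> are pinned to 0; the box is then compact by Tychonoff's theorem.\<close>
  define B :: "('a \<Rightarrow> real) set" where
    "B = PiE UNIV (\<lambda>x. if x \<in> V then {- R..R} else {0})"
  have "compactin (product_topology (\<lambda>_. euclidean) UNIV) B"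
    unfolding B_def by (subst compactin_PiE) auto
  then have "compact B"
    by (simp add: euclidean_product_topology)
  moreover have "closed {u. Z u = 1}"
    using continuous_Z by (intro closed_Collect_eq continuous_intros) auto
  ultimately have "compact (B \<inter> {u. Z u = 1})"
    by (rule compact_Int_closed)
  \<comment> \<open>Truncation outside \<open>V\<close> preserves \<open>J\<close> and
    \<open>Z\<close> and moves each competitor no worse than \<open>v0\<close> into
    \<open>B\<close>. Worse competitors are compared through \<open>v0\<close>.\<close>
  moreover define r where "r = (\<lambda>u x. if x \<in> V then u x else (0::real))"
  have r: "Z (r u) = Z u" "J (r u) = J u" for u
    by (auto simp: r_def intro!: Z_cong J_cong)
  have rB: "r u \<in> B \<inter> {u. Z u = 1}" if "Z u = 1" "J u \<le> J v0" for u
    using that R[OF that] r(1)[of u] by (auto simp: B_def r_def abs_le_iff minus_le_iff)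
  moreover have "continuous_on (B \<inter> {u. Z u = 1}) J"
    using continuous_J continuous_on_subset by blast
  ultimately obtain u where u: "u \<in> B \<inter> {u. Z u = 1}"
      and min: "\<And>v. v \<in> B \<inter> {u. Z u = 1} \<Longrightarrow> J u \<le> J v"
    using continuous_attains_inf[of "B \<inter> {u. Z u = 1}" J] v0 by blast
  have "J u \<le> J v" if "Z v = 1" for v
  proof (cases "J v \<le> J v0")
    case True
    then show ?thesis
      using min[OF rB] that r by simp
  next
    case False
    then show ?thesis
      using min[OF rB[OF v0]] r by simp
  qed
  then show ?thesis
    using that u by blast
qed

section \<open>First variation and Euler-Lagrange equation\<close>

lemma DERIV_energy:
  "((\<lambda>t. energy (\<lambda>x. u x + t * \<phi> x)) has_real_derivative - 4 * (\<Sum>x\<in>V. \<phi> x * lap u x)) (at 0)"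
proof -
  have "((\<lambda>t. energy (\<lambda>x. u x + t * \<phi> x)) has_real_derivative
      (\<Sum>x\<in>V. \<Sum>y\<in>V. 2 * (a x y * ((u y - u x) * (\<phi> y - \<phi> x))))) (at 0)"
    unfolding energy_def by (rule derivative_eq_intros refl | simp add: mult_ac)+
  then show ?thesis
    using green[of u \<phi>] by (simp add: sum_distrib_left[symmetric])
qed

lemma DERIV_Z:
  "((\<lambda>t. Z (\<lambda>x. u x + t * \<phi> x)) has_real_derivative (\<Sum>x\<in>V. \<phi> x * (k x * exp (u x)))) (at 0)"
  unfolding Z_def by (rule derivative_eq_intros refl | simp add: mult_ac)+

lemma DERIV_J:
  "((\<lambda>t. J (\<lambda>x. u x + t * \<phi> x)) has_real_derivative
     - (\<Sum>x\<in>V. \<phi> x * lap u x) + (\<Sum>x\<in>V. \<phi> x * m x)) (at 0)"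
  unfolding J_def by (rule derivative_eq_intros DERIV_energy refl | simp add: mult_ac)+

lemma euler_lagrange:
  assumes Z: "Z u = 1" and min: "\<And>v. Z v = 1 \<Longrightarrow> J u \<le> J v" and x: "x \<in> V"
  shows "lap u x = m x - sum m V * (k x * exp (u x))"
proof -
  define \<phi> :: "'a \<Rightarrow> real" where "\<phi> = (\<lambda>y. if y = x then 1 else 0)"
  define v where "v = (\<lambda>t y. u y + t * \<phi> y)"
  \<comment> \<open>\<open>F t\<close> is \<open>J\<close> of \<open>v t\<close> shifted back onto
    the constraint, wherever \<open>Z (v t) > 0\<close>. Hence \<open>F\<close> has a local minimum
    at 0, with no Lagrange multiplier needed.\<close>
  define F where "F = (\<lambda>t. J (v t) + sum m V * - ln (Z (v t)))"
  have v0: "v 0 = u"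
    by (simp add: v_def)
  have test: "(\<Sum>y\<in>V. \<phi> y * f y) = f x" for f
    using x finite_V by (simp add: \<phi>_def if_distrib[of "\<lambda>z. z * _"] cong: if_cong)
  have dJ: "((\<lambda>t. J (v t)) has_real_derivative - lap u x + m x) (at 0)"
    using DERIV_J[of u \<phi>] by (simp add: v_def test)
  have dZ: "((\<lambda>t. Z (v t)) has_real_derivative k x * exp (u x)) (at 0)"
    using DERIV_Z[of u \<phi>] by (simp add: v_def test)
  have dF: "(F has_real_derivative - lap u x + m x - sum m V * (k x * exp (u x))) (at 0)"
    unfolding F_def by (rule derivative_eq_intros dJ dZ refl | simp add: v0 Z)+
  have "((\<lambda>t. Z (v t)) \<longlongrightarrow> Z (v 0)) (at 0)"
    using DERIV_isCont[OF dZ] by (simp add: isCont_def)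
  then have "\<forall>\<^sub>F t in at 0. Z (v t) > 0"
    by (rule order_tendstoD) (simp add: v0 Z)
  then obtain d where d: "d > 0" "\<And>t. t \<noteq> 0 \<Longrightarrow> \<bar>t\<bar> < d \<Longrightarrow> Z (v t) > 0"
    by (auto simp: eventually_at dist_real_def)
  have "F 0 \<le> F t" if "\<bar>0 - t\<bar> < d" for t
  proof -
    have "Z (v t) > 0"
      using d(2)[of t] that by (cases "t = 0") (auto simp: v0 Z)
    then have "J u \<le> J (\<lambda>x. v t x + - ln (Z (v t)))"
      by (intro min Z_normalize)
    then show ?thesis
      unfolding F_def by (subst (asm) J_add_const) (simp add: v0 Z)
  qed
  then have "- lap u x + m x - sum m V * (k x * exp (u x)) = 0"
    using d(1) dF by (intro DERIV_local_min[of F _ 0 d]) auto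
  then show ?thesis by simp
qed

theorem kazdan_warner:
  "(\<exists>u. \<forall>x\<in>V. lap u x = m x - k x * exp (u x)) \<longleftrightarrow> (\<exists>x\<in>V. k x > 0)"
proof
  assume "\<exists>u. \<forall>x\<in>V. lap u x = m x - k x * exp (u x)"
  then obtain u where u: "\<And>x. x \<in> V \<Longrightarrow> lap u x = m x - k x * exp (u x)" by blast
  then have "(\<Sum>x\<in>V. k x * exp (u x)) = sum m V"
    using sum_lap[of u] by (simp add: sum_subtractf)
  then have "(\<Sum>x\<in>V. k x * exp (u x)) > 0"
    using total_mass_pos by simp
  moreover have "(\<Sum>x\<in>V. k x * exp (u x)) \<le> 0" if "\<not> (\<exists>x\<in>V. k x > 0)"
    using that by (intro sum_nonpos mult_nonpos_nonneg) (auto simp: not_less)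
  ultimately show "\<exists>x\<in>V. k x > 0"
    by force
next
  assume "\<exists>x\<in>V. k x > 0"
  then obtain v where "Z v > 0"
    using exists_Z_pos by blast
  then obtain u where u: "Z u = 1" "\<And>v. Z v = 1 \<Longrightarrow> J u \<le> J v"
    using exists_minimizer by metis
  \<comment> \<open>The Euler-Lagrange equation carries the factor \<open>K\<close> before the
    exponential; adding \<open>ln K\<close> to \<open>u\<close> absorbs it and leaves
    \<open>lap\<close> unchanged.\<close>
  define K where "K = sum m V"
  have "lap (\<lambda>x. u x + ln K) x = m x - k x * exp (u x + ln K)" if "x \<in> V" for x
  proof -
    have "exp (u x + ln K) = K * exp (u x)"
      using total_mass_pos by (simp add: K_def exp_add)
    moreover have "lap u x = m x - K * (k x * exp (u x))"
      unfolding K_def by (rule euler_lagrange[OF u that])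
    ultimately show ?thesis
      by (simp only: lap_add_const mult.left_commute)
  qed
  then show "\<exists>u. \<forall>x\<in>V. lap u x = m x - k x * exp (u x)"
    by (intro exI[of _ "\<lambda>x. u x + ln K"] ballI)
qed

end

end

section \<open>The equation on a weighted graph\<close>

text \<open>Positive weights make the positive-conductance relation coincide with adjacency.
  Connectedness is strong connectedness of the symmetric closure, which has the same reachability as
  the symmetric \<open>G\<close>.\<close>

lemma network_of_graph:
  assumes "graph G" and "Digraph_Component.connected G"
    and sym: "\<And>x y. x \<rightarrow>\<^bsub>G\<^esub> y \<Longrightarrow> w x y = w y x"
    and pos: "\<And>x y. x \<rightarrow>\<^bsub>G\<^esub> y \<Longrightarrow> w x y > (0::real)"
  shows "network (verts G) (\<lambda>x y. if x \<rightarrow>\<^bsub>G\<^esub> y then w x y else 0)"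
proof -
  interpret graph G by fact
  have symG: "x \<rightarrow>\<^bsub>G\<^esub> y \<longleftrightarrow> y \<rightarrow>\<^bsub>G\<^esub> x" for x y
    using arcs_ends_symmetric[OF sym_arcs] by auto
  have arcs: "{(x, y). (if x \<rightarrow>\<^bsub>G\<^esub> y then w x y else 0) > 0} = arcs_ends G"
    using pos by auto
  have sc: "strongly_connected (mk_symmetric G)"
    using assms(2) by (simp add: Digraph_Component.connected_def)
  show ?thesis
  proof
    show "finite (verts G)"
      by simp
    show "verts G \<noteq> {}"
      using sc by (simp add: strongly_connected_def)
  next
    fix x y
    show "(if x \<rightarrow>\<^bsub>G\<^esub> y then w x y else 0) \<ge> 0"
      using less_imp_le[OF pos] by simp
    show "(if x \<rightarrow>\<^bsub>G\<^esub> y then w x y else 0) = (if y \<rightarrow>\<^bsub>G\<^esub> x then w y x else 0)"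
      using symG[of x y] sym[of x y] by (cases "x \<rightarrow>\<^bsub>G\<^esub> y") simp_all
    show "y \<in> verts G" if "(if x \<rightarrow>\<^bsub>G\<^esub> y then w x y else 0) > 0"
      using that adj_in_verts(2) by (auto split: if_splits)
    show "(x, y) \<in> {(x, y). (if x \<rightarrow>\<^bsub>G\<^esub> y then w x y else 0) > 0}\<^sup>*"
      if "x \<in> verts G" "y \<in> verts G"
    proof -
      have "x \<rightarrow>\<^sup>*\<^bsub>mk_symmetric G\<^esub> y"
        using sc that by (auto simp: strongly_connected_def)
      then have "x \<rightarrow>\<^sup>*\<^bsub>G\<^esub> y"
        by (simp only: reachable_mk_symmetric_eq[OF sym_arcs])
      then show ?thesis
        unfolding arcs by (rule reachable_rtranclI)
    qed
  qed
qed

theorem theorem2: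
  fixes G :: "('a, 'b) pre_digraph"
    and w :: "'a \<Rightarrow> 'a \<Rightarrow> real"
    and \<mu> h :: "'a \<Rightarrow> real"
    and c :: real
  assumes "graph G"
    and "Digraph_Component.connected G"
    and "\<And>x y. x \<rightarrow>\<^bsub>G\<^esub> y \<Longrightarrow> w x y = w y x"
    and "\<And>x y. x \<rightarrow>\<^bsub>G\<^esub> y \<Longrightarrow> w x y > 0"
    and "\<And>x. x \<in> verts G \<Longrightarrow> \<mu> x > 0"
    and "c > 0"
  shows "(\<exists>u :: 'a \<Rightarrow> real. \<forall>x \<in> verts G. mu_laplacian G w \<mu> u x = c - h x * exp (u x))
    \<longleftrightarrow> (\<exists>x \<in> verts G. h x > 0)"
proof -
  interpret graph G by fact
  interpret network "verts G" "\<lambda>x y. if x \<rightarrow>\<^bsub>G\<^esub> y then w x y else 0"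
    using assms by (intro network_of_graph)
  have "lap u x = (\<Sum>y | x \<rightarrow>\<^bsub>G\<^esub> y. w x y * (u y - u x))" for u x
    unfolding lap_def
    by (intro sum.mono_neutral_cong_right) (auto dest: adj_in_verts)
  then have "mu_laplacian G w \<mu> u x = lap u x / \<mu> x" for u x
    by (simp add: mu_laplacian_def)
  then have eq: "mu_laplacian G w \<mu> u x = c - h x * exp (u x)
      \<longleftrightarrow> lap u x = \<mu> x * c - \<mu> x * h x * exp (u x)" if "x \<in> verts G" for u x
    using assms(5)[OF that] by (simp add: field_simps)
  have "(\<exists>u. \<forall>x\<in>verts G. mu_laplacian G w \<mu> u x = c - h x * exp (u x))
      \<longleftrightarrow> (\<exists>u. \<forall>x\<in>verts G. lap u x = \<mu> x * c - \<mu> x * h x * exp (u x))"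
    by (intro ex_cong1 ball_cong refl eq)
  \<comment> \<open>Multiplication by the measure has put the equation in network form, with
    \<open>m x = \<mu> x * c\<close> and \<open>k x = \<mu> x * h x\<close>.\<close>
  also have "\<dots> \<longleftrightarrow> (\<exists>x\<in>verts G. \<mu> x * h x > 0)"
    using assms(5,6) by (intro kazdan_warner) auto
  also have "\<dots> \<longleftrightarrow> (\<exists>x\<in>verts G. h x > 0)"
    using assms(5) by (auto simp: zero_less_mult_iff dest: less_asym)
  finally show ?thesis .
qed

end
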